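(* For every $(\beta,\alpha) \in \mathbb{R}^2$ with $\beta \in (1,2]$ and $\alpha \in [0,2-\beta]$, the $\beta$-transformation $T_{\beta,\alpha} : [0,1] \to [0,1]$, $T_{\beta,\alpha}(x) = \beta x + \alpha \pmod 1$, does not have finite shadowing, and hence does not have shadowing.
   Context: Here $\mathbb{N}_0 = \{0,1,2,\dots\}$, $[0,1]$ carries the usual metric $\mathrm{d}(x,y)=|x-y|$, and $y \pmod 1$ denotes the fractional part $y - \lfloor y \rfloor$. Shadowing: let $(X,\mathrm{d})$ be a compact metric space and $f : X \to X$ a map (not assumed continuous). For $\delta>0$, a $\delta$-pseudo-orbit of $f$ is a sequence $(x_i)_{i \in \mathbb{N}_0}$ in $X$ with $\mathrm{d}(f(x_i),x_{i+1}) < \delta$ for all $i \in \mathbb{N}_0$; a finite $\delta$-pseudo-orbit is a finite sequence $(x_i)_{i \in \{0,\dots,n\}}$ in $X$ with $\mathrm{d}(f(x_i),x_{i+1}) < \delta$ for all $i \in \{0,\dots,n-1\}$. The map $f$ has shadowing if for every $\epsilon>0$ there exists $\delta>0$ such that for every $\delta$-pseudo-orbit $(x_i)_{i\in\mathbb{N}_0}$ there is $x \in X$ with $\mathrm{d}(f^i(x),x_i)<\epsilon$ for all $i \in \mathbb{N}_0$. The map $f$ has finite shadowing if for every $\epsilon>0$ there exists $\delta>0$ such that for every $n$ and every finite $\delta$-pseudo-orbit $(x_i)_{i\in\{0,\dots,n\}}$ there is $z \in X$ with $\mathrm{d}(f^i(z),x_i)<\epsilon$ for all $i \in \{0,\dots,n\}$.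 *)

theory Defs
  imports Complex_Main
begin

text \<open>
  A self-map of a metric space \<open>X\<close> is represented by a function on the ambient type together
  with the carrier \<open>X\<close>, considered with the restriction of \<open>dist\<close>. The intended use is for
  compact \<open>X\<close> and maps with \<open>f ` X \<subseteq> X\<close>; continuity of \<open>f\<close> is not required.
\<close>

definition pseudo_orbit ::
    "'a::metric_space set \<Rightarrow> ('a \<Rightarrow> 'a) \<Rightarrow> real \<Rightarrow> (nat \<Rightarrow> 'a) \<Rightarrow> bool" where
  "pseudo_orbit X f \<delta> x \<longleftrightarrow> (\<forall>i. x i \<in> X) \<and> (\<forall>i. dist (f (x i)) (x (Suc i)) < \<delta>)"

text \<open>
  A finite sequence indexed by \<open>{0..n}\<close> is a function on \<open>nat\<close> whose values beyond \<open>n\<close> are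
  irrelevant.
\<close>

definition finite_pseudo_orbit ::
    "'a::metric_space set \<Rightarrow> ('a \<Rightarrow> 'a) \<Rightarrow> real \<Rightarrow> nat \<Rightarrow> (nat \<Rightarrow> 'a) \<Rightarrow> bool" where
  "finite_pseudo_orbit X f \<delta> n x \<longleftrightarrow>
     (\<forall>i\<le>n. x i \<in> X) \<and> (\<forall>i<n. dist (f (x i)) (x (Suc i)) < \<delta>)"

definition has_shadowing :: "'a::metric_space set \<Rightarrow> ('a \<Rightarrow> 'a) \<Rightarrow> bool" where
  "has_shadowing X f \<longleftrightarrow>
     (\<forall>\<epsilon>>0. \<exists>\<delta>>0. \<forall>x. pseudo_orbit X f \<delta> x \<longrightarrow>
        (\<exists>z\<in>X. \<forall>i. dist ((f ^^ i) z) (x i) < \<epsilon>))"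

definition has_finite_shadowing :: "'a::metric_space set \<Rightarrow> ('a \<Rightarrow> 'a) \<Rightarrow> bool" where
  "has_finite_shadowing X f \<longleftrightarrow>
     (\<forall>\<epsilon>>0. \<exists>\<delta>>0. \<forall>n x. finite_pseudo_orbit X f \<delta> n x \<longrightarrow>
        (\<exists>z\<in>X. \<forall>i\<le>n. dist ((f ^^ i) z) (x i) < \<epsilon>))"

definition beta_transformation :: "real \<Rightarrow> real \<Rightarrow> real \<Rightarrow> real" where
  "beta_transformation \<beta> \<alpha> x = frac (\<beta> * x + \<alpha>)"

lemma beta_transformation_in_unit_interval: "beta_transformation \<beta> \<alpha> x \<in> {0..1}"
  by (simp add: beta_transformation_def less_imp_le[OF frac_lt_1])

end

theory Submission
  imports Defs
begin

text \<open>
  The map \<open>T = beta_transformation \<beta> \<alpha>\<close> is increasing with slope \<open>\<beta> > 1\<close> on either side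
  of its discontinuity \<open>c = (1 - \<alpha>) / \<beta>\<close>, where it falls from \<open>1\<close> to \<open>0\<close>.

  Suppose first that \<open>\<beta> + \<alpha> < 2\<close>. Start a pseudo-orbit \<open>y\<close> at the right end point \<open>1\<close> of the
  interval and let every jump go upwards by at least some \<open>\<eta> > 0\<close>. A shadowing orbit \<open>z\<close> starts
  at or below \<open>y\<close>. As long as the two lie on the same branch, monotonicity and
  expansion give \<open>y' - z' \<ge> (y - z) + \<eta>\<close>. If they are ever close but separated by \<open>c\<close>, then
  \<open>z < c \<le> y\<close>, so \<open>z\<close> is thrown close to \<open>1\<close> and \<open>y\<close> close to \<open>0\<close>. Hence either the
  distance grows linearly or it becomes large at once, and in both cases shadowing fails
  (lemma \<open>upward_drift_step\<close>). Upward jumps could push \<open>y\<close> out of the interval only if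
  \<open>T y\<close> were close to \<open>1\<close>, that is, if \<open>y\<close> lay just below \<open>c\<close>. The pseudo-orbit therefore skips
  the gap \<open>{c - \<eta><..<c}\<close>: the jump is doubled, and so carried beyond \<open>c\<close>, whenever \<open>T y\<close>
  lies below \<open>c\<close> by at most \<open>2 * \<eta>\<close> (lemma \<open>upward_step_invariant\<close>).

  If \<open>\<beta> + \<alpha> = 2\<close>, then \<open>T\<close> has left limit \<open>1\<close> at \<open>1\<close> but \<open>T 1 = 0\<close>. The pseudo-orbit that goes
  from just below \<open>c\<close> to \<open>1\<close> and then to \<open>0\<close> cannot be shadowed: points of the range of \<open>T\<close> are
  less than \<open>1\<close>, and those close to \<open>1\<close> stay close to \<open>1\<close>.
\<close>

section \<open>Shadowing implies finite shadowing\<close>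

text \<open>A finite pseudo-orbit extends to an infinite one by following the true orbit of its last
  point.\<close>

lemma has_shadowing_imp_has_finite_shadowing:
  assumes "f ` X \<subseteq> X" and "has_shadowing X f"
  shows "has_finite_shadowing X f"
  unfolding has_finite_shadowing_def
proof (intro allI impI)
  fix \<epsilon> :: real
  assume "\<epsilon> > 0"
  then obtain \<delta> where "\<delta> > 0" and shadow:
    "\<And>x. pseudo_orbit X f \<delta> x \<Longrightarrow> \<exists>z\<in>X. \<forall>i. dist ((f ^^ i) z) (x i) < \<epsilon>"
    using assms(2) unfolding has_shadowing_def by blast
  have "\<exists>z\<in>X. \<forall>i\<le>n. dist ((f ^^ i) z) (x i) < \<epsilon>" if fin: "finite_pseudo_orbit X f \<delta> n x" for n x
  proof -
    define y where "y i = (if i \<le> n then x i else (f ^^ (i - n)) (x n))" for i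
    have "(f ^^ k) (x n) \<in> X" for k
      using assms(1) fin by (induction k) (auto simp: finite_pseudo_orbit_def)
    then have "y i \<in> X" for i
      using fin by (auto simp: y_def finite_pseudo_orbit_def)
    moreover have "dist (f (y i)) (y (Suc i)) < \<delta>" for i
    proof (cases "i < n")
      case True
      then show ?thesis using fin by (auto simp: y_def finite_pseudo_orbit_def)
    next
      case False
      then have "y (Suc i) = f (y i)"
        by (auto simp: y_def Suc_diff_le not_less le_eq_less_or_eq)
      then show ?thesis using \<open>\<delta> > 0\<close> by simp
    qed
    ultimately have "pseudo_orbit X f \<delta> y"
      by (simp add: pseudo_orbit_def)
    then obtain z where "z \<in> X" and "\<And>i. dist ((f ^^ i) z) (y i) < \<epsilon>"
      using shadow by blast
    moreover have "y i = x i" if "i \<le> n" for i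
      using that by (simp add: y_def)
    ultimately show ?thesis by metis
  qed
  then show "\<exists>\<delta>>0. \<forall>n x. finite_pseudo_orbit X f \<delta> n x \<longrightarrow>
      (\<exists>z\<in>X. \<forall>i\<le>n. dist ((f ^^ i) z) (x i) < \<epsilon>)"
    using \<open>\<delta> > 0\<close> by blast
qed

section \<open>A pseudo-orbit that drifts upwards\<close>

lemma beta_transformation_below_discontinuity:
  assumes "\<beta> > 0" "\<alpha> \<ge> 0" "0 \<le> x" "x < (1 - \<alpha>) / \<beta>"
  shows "beta_transformation \<beta> \<alpha> x = \<beta> * x + \<alpha>"
proof -
  have "\<beta> * x + \<alpha> < 1" using assms by (simp add: field_simps)
  moreover have "0 \<le> \<beta> * x + \<alpha>" using assms by simp
  ultimately show ?thesis by (simp add: beta_transformation_def frac_eq)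
qed

lemma beta_transformation_above_discontinuity:
  assumes "\<beta> > 0" "\<beta> + \<alpha> < 2" "x \<le> 1" "(1 - \<alpha>) / \<beta> \<le> x"
  shows "beta_transformation \<beta> \<alpha> x = \<beta> * x + \<alpha> - 1"
proof -
  have "1 \<le> \<beta> * x + \<alpha>" using assms by (simp add: field_simps)
  moreover have "\<beta> * x \<le> \<beta>" using assms by simp
  then have "\<beta> * x + \<alpha> < 2" using assms by linarith
  ultimately show ?thesis by (simp add: beta_transformation_def frac_unique_iff)
qed

definition upward_jump :: "real \<Rightarrow> real \<Rightarrow> real \<Rightarrow> real" where
  "upward_jump c \<eta> u = (if u < c \<and> c \<le> u + 2 * \<eta> then u + 2 * \<eta> else u + \<eta>)"

lemma upward_jump_bounds:
  assumes "\<eta> > 0"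
  shows "u + \<eta> \<le> upward_jump c \<eta> u" "upward_jump c \<eta> u \<le> u + 2 * \<eta>"
  using assms by (simp_all add: upward_jump_def)

text \<open>Staying out of the gap below \<open>c\<close> keeps \<open>T y \<le> 1 - \<eta>\<close>, which leaves room for the next jump.
  The bound on \<open>\<beta> + \<alpha>\<close> does the same for the branch above \<open>c\<close>.\<close>

lemma upward_step_invariant:
  fixes \<alpha> \<beta> \<eta> y :: real
  defines "c \<equiv> (1 - \<alpha>) / \<beta>"
  assumes \<beta>: "\<beta> > 1" and \<alpha>: "\<alpha> \<ge> 0"
    and \<eta>: "\<eta> > 0" "\<beta> + \<alpha> + \<eta> \<le> 2" "c + 2 * \<eta> \<le> 1"
    and y: "y \<in> {0..1} - {c - \<eta><..<c}"
  shows "upward_jump c \<eta> (beta_transformation \<beta> \<alpha> y) \<in> {0..1} - {c - \<eta><..<c}"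
proof -
  let ?u = "beta_transformation \<beta> \<alpha> y"
  have "0 \<le> ?u" using beta_transformation_in_unit_interval[of \<beta> \<alpha> y] by simp
  moreover have "?u + \<eta> \<le> 1"
  proof (cases "y < c")
    case True
    then have "y \<le> c - \<eta>" using y by auto
    then have "\<beta> * y \<le> \<beta> * (c - \<eta>)" using \<beta> by simp
    also have "\<dots> = \<beta> * c - \<beta> * \<eta>" by (simp add: right_diff_distrib)
    also have "\<beta> * c = 1 - \<alpha>" using \<beta> unfolding c_def by simp
    finally have "\<beta> * y + \<alpha> \<le> 1 - \<beta> * \<eta>" by simp
    moreover have "\<eta> \<le> \<beta> * \<eta>" using \<beta> \<eta> by simp
    moreover have "?u = \<beta> * y + \<alpha>"
      using beta_transformation_below_discontinuity[of \<beta> \<alpha> y] True \<beta> \<alpha> y by (simp add: c_def)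
    ultimately show ?thesis by linarith
  next
    case False
    then have "?u = \<beta> * y + \<alpha> - 1"
      using beta_transformation_above_discontinuity[of \<beta> \<alpha> y] \<beta> \<eta> y by (simp add: c_def)
    moreover have "\<beta> * y \<le> \<beta>" using \<beta> y by simp
    ultimately show ?thesis using \<eta> by linarith
  qed
  ultimately show ?thesis using \<eta> by (auto simp: upward_jump_def)
qed

text \<open>On a common branch the gap expands and then gains the jump. On different branches the
  images are almost at opposite ends of the interval, which two close points with close
  successors cannot be.\<close>

lemma upward_drift_step:
  fixes \<alpha> \<beta> \<eta> y z :: real
  defines "c \<equiv> (1 - \<alpha>) / \<beta>"
  defines "T \<equiv> beta_transformation \<beta> \<alpha>"
  assumes \<beta>: "\<beta> \<in> {1<..2}" and \<alpha>: "\<alpha> \<ge> 0" "\<beta> + \<alpha> < 2"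
    and \<eta>: "\<eta> > 0" "\<eta> \<le> 1 / 5"
    and yz: "0 \<le> z" "z \<le> y" "y \<le> 1"
    and close: "y - z < 1 / 5" and close': "\<bar>upward_jump c \<eta> (T y) - T z\<bar> < 1 / 5"
  shows "y - z + \<eta> \<le> upward_jump c \<eta> (T y) - T z"
proof -
  note jump = upward_jump_bounds[OF \<eta>(1), where u = "T y" and c = c]
  have low: "T x = \<beta> * x + \<alpha>" if "0 \<le> x" "x < c" for x
    using beta_transformation_below_discontinuity[of \<beta> \<alpha> x] that \<beta> \<alpha> by (simp add: c_def T_def)
  have high: "T x = \<beta> * x + \<alpha> - 1" if "x \<le> 1" "c \<le> x" for x
    using beta_transformation_above_discontinuity[of \<beta> \<alpha> x] that \<beta> \<alpha> by (simp add: c_def T_def)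
  have expand: "y - z \<le> \<beta> * (y - z)" "\<beta> * (y - z) \<le> 2 * (y - z)"
    using \<beta> yz mult_right_mono[of 1 \<beta> "y - z"] mult_right_mono[of \<beta> 2 "y - z"] by simp_all
  have dist_eq: "\<beta> * (y - z) = \<beta> * y - \<beta> * z" by (simp add: algebra_simps)
  consider "y < c" | "c \<le> z" | "z < c" "c \<le> y" by linarith
  then show ?thesis
  proof cases
    case 1
    then show ?thesis using low[of y] low[of z] yz jump expand dist_eq by linarith
  next
    case 2
    then show ?thesis using high[of y] high[of z] yz jump expand dist_eq by linarith
  next
    case 3
    then have "T z - T y = 1 - \<beta> * (y - z)"
      using low[of z] high[of y] yz dist_eq by linarith
    moreover have "T z - upward_jump c \<eta> (T y) < 1 / 5" using close' by linarith
    (* T z - T y > 3/5, and the jump recovers at most 2/5 of it. *)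
    ultimately have False using jump(2) expand(2) close \<eta>(2) by argo
    then show ?thesis ..
  qed
qed

lemma not_has_finite_shadowing_lt2:
  assumes \<beta>: "\<beta> \<in> {1<..2}" and \<alpha>: "\<alpha> \<ge> 0" "\<beta> + \<alpha> < 2"
  shows "\<not> has_finite_shadowing {0..1} (beta_transformation \<beta> \<alpha>)"
proof
  define c where "c = (1 - \<alpha>) / \<beta>"
  define T where "T = beta_transformation \<beta> \<alpha>"
  assume "has_finite_shadowing {0..1} (beta_transformation \<beta> \<alpha>)"
  moreover have "(1 / 5 :: real) > 0" by simp
  ultimately obtain \<delta> where "\<delta> > 0" and shadow:
    "\<And>n x. finite_pseudo_orbit {0..1} T \<delta> n x \<Longrightarrow>
        \<exists>z\<in>{0..1}. \<forall>i\<le>n. dist ((T ^^ i) z) (x i) < 1 / 5"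
    unfolding has_finite_shadowing_def T_def by blast
  have "c < 1" using \<beta> \<alpha> by (simp add: c_def field_simps)
  (* In order: a double jump is below \<delta>; an orbit separated by c is still visibly far after a
     double jump; a jump from the top of the right branch stays below 1, and so does a double
     jump that passes c. *)
  define \<eta> where "\<eta> = Min {\<delta> / 3, 1 / 5, 2 - \<beta> - \<alpha>, (1 - c) / 2}"
  have "\<eta> > 0" using \<open>\<delta> > 0\<close> \<open>c < 1\<close> \<alpha> by (simp add: \<eta>_def)
  have "\<eta> \<le> \<delta> / 3" "\<eta> \<le> 1 / 5" "\<eta> \<le> 2 - \<beta> - \<alpha>" "\<eta> \<le> (1 - c) / 2"
    unfolding \<eta>_def by (rule Min_le; simp)+
  then have \<eta>: "2 * \<eta> < \<delta>" "\<eta> \<le> 1 / 5" "\<beta> + \<alpha> + \<eta> \<le> 2" "c + 2 * \<eta> \<le> 1"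
    using \<open>\<delta> > 0\<close> by (auto simp: field_simps)
  define y where "y i = ((\<lambda>x. upward_jump c \<eta> (T x)) ^^ i) 1" for i
  have y_Suc: "y (Suc i) = upward_jump c \<eta> (T (y i))" for i by (simp add: y_def)
  have "y i \<in> {0..1} - {c - \<eta><..<c}" for i
  proof (induction i)
    case 0
    then show ?case using \<open>c < 1\<close> by (simp add: y_def)
  next
    case (Suc i)
    then show ?case
      using upward_step_invariant[of \<beta> \<alpha> \<eta> "y i"] \<beta> \<alpha> \<eta> \<open>\<eta> > 0\<close>
      unfolding y_Suc c_def T_def by simp
  qed
  then have y_unit: "y i \<in> {0..1}" for i by blast
  obtain n :: nat where n: "1 / 5 < n * \<eta>"
    using reals_Archimedean3[OF \<open>\<eta> > 0\<close>] by blast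
  have "dist (T (y i)) (y (Suc i)) < \<delta>" for i
    using upward_jump_bounds[OF \<open>\<eta> > 0\<close>, where u = "T (y i)" and c = c] \<open>\<eta> > 0\<close> \<eta>(1)
    by (simp add: y_Suc dist_real_def)
  then have "finite_pseudo_orbit {0..1} T \<delta> n y"
    using y_unit by (auto simp: finite_pseudo_orbit_def)
  then obtain z where z: "z \<in> {0..1}" and "\<forall>i\<le>n. dist ((T ^^ i) z) (y i) < 1 / 5"
    using shadow by blast
  then have close: "\<bar>(T ^^ i) z - y i\<bar> < 1 / 5" if "i \<le> n" for i
    using that by (simp add: dist_real_def)
  have z_unit: "(T ^^ i) z \<in> {0..1}" for i
    using z beta_transformation_in_unit_interval by (cases i) (auto simp: T_def)
  have "i * \<eta> \<le> y i - (T ^^ i) z" if "i \<le> n" for i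
    using that
  proof (induction i)
    case 0
    then show ?case using z by (simp add: y_def)
  next
    case (Suc i)
    then have IH: "i * \<eta> \<le> y i - (T ^^ i) z" by simp
    moreover have "0 \<le> i * \<eta>" using \<open>\<eta> > 0\<close> by simp
    ultimately have "(T ^^ i) z \<le> y i" by linarith
    moreover have "y i - (T ^^ i) z < 1 / 5" using close[of i] Suc.prems by linarith
    moreover have "\<bar>upward_jump c \<eta> (T (y i)) - T ((T ^^ i) z)\<bar> < 1 / 5"
      using close[OF Suc.prems] by (simp add: y_Suc abs_minus_commute)
    ultimately have "y i - (T ^^ i) z + \<eta> \<le> y (Suc i) - (T ^^ Suc i) z"
      using upward_drift_step[of \<beta> \<alpha> \<eta> "(T ^^ i) z" "y i"] \<beta> \<alpha> \<eta> \<open>\<eta> > 0\<close> y_unit[of i] z_unit[of i]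
      by (simp add: y_Suc c_def T_def)
    then show ?case using IH by (simp add: algebra_simps)
  qed
  from this[of n] close[of n] n show False by simp
qed

section \<open>The case of the full right branch\<close>

lemma not_has_finite_shadowing_eq2:
  assumes \<beta>: "\<beta> \<in> {1<..2}" and sum: "\<beta> + \<alpha> = 2"
  shows "\<not> has_finite_shadowing {0..1} (beta_transformation \<beta> \<alpha>)"
proof
  define c where "c = (1 - \<alpha>) / \<beta>"
  define T where "T = beta_transformation \<beta> \<alpha>"
  assume "has_finite_shadowing {0..1} (beta_transformation \<beta> \<alpha>)"
  moreover have "(1 / 5 :: real) > 0" by simp
  ultimately obtain \<delta> where "\<delta> > 0" and shadow:
    "\<And>n x. finite_pseudo_orbit {0..1} T \<delta> n x \<Longrightarrow>
        \<exists>z\<in>{0..1}. \<forall>i\<le>n. dist ((T ^^ i) z) (x i) < 1 / 5"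
    unfolding has_finite_shadowing_def T_def by blast
  have "0 < c" "c < 1" using \<beta> sum by (auto simp: c_def field_simps)
  define \<eta> where "\<eta> = min (\<delta> / 3) c"
  have \<eta>: "0 < \<eta>" "\<eta> \<le> \<delta> / 3" "\<eta> \<le> c" using \<open>\<delta> > 0\<close> \<open>0 < c\<close> by (auto simp: \<eta>_def)
  define y :: "nat \<Rightarrow> real" where "y i = (if i = 0 then c - \<eta> else if i = 1 then 1 else 0)" for i
  have "T (c - \<eta>) = \<beta> * (c - \<eta>) + \<alpha>"
    using beta_transformation_below_discontinuity[of \<beta> \<alpha> "c - \<eta>"] \<beta> sum \<eta>
    by (simp add: T_def c_def)
  also have "\<dots> = \<beta> * c + \<alpha> - \<beta> * \<eta>" by (simp add: right_diff_distrib)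
  also have "\<beta> * c = 1 - \<alpha>" using \<beta> unfolding c_def by simp
  finally have "T (c - \<eta>) = 1 - \<beta> * \<eta>" by simp
  moreover have "\<beta> * \<eta> \<le> 2 * \<eta>" "0 \<le> \<beta> * \<eta>" using \<beta> \<eta> by auto
  ultimately have "\<bar>T (c - \<eta>) - 1\<bar> < \<delta>"
    using \<eta> \<open>\<delta> > 0\<close> by linarith
  then have "dist (T (c - \<eta>)) 1 < \<delta>" by (simp add: dist_real_def)
  moreover have "T 1 = 0" using sum by (simp add: T_def beta_transformation_def)
  ultimately have "finite_pseudo_orbit {0..1} T \<delta> 2 y"
    using \<eta> \<open>c < 1\<close> \<open>\<delta> > 0\<close>
    by (auto simp: finite_pseudo_orbit_def y_def less_2_cases_iff)
  then obtain z where close: "\<And>i. i \<le> 2 \<Longrightarrow> dist ((T ^^ i) z) (y i) < 1 / 5"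
    using shadow by blast
  define w where "w = T z"
  have "\<bar>w - 1\<bar> < 1 / 5" using close[of 1] by (simp add: w_def y_def dist_real_def)
  moreover have "w < 1" by (simp add: w_def T_def beta_transformation_def frac_lt_1)
  ultimately have w: "4 / 5 < w" "w < 1" by auto
  have "\<bar>T w\<bar> < 1 / 5" using close[of 2] by (simp add: w_def y_def dist_real_def numeral_2_eq_2)
  moreover have "T w = 1 - \<beta> * (1 - w)" and "3 / 5 < 1 - \<beta> * (1 - w)"
  proof -
    have *: "0 < \<beta> * (1 - w)" "\<beta> * (1 - w) \<le> 2 * (1 - w)"
      using \<beta> w mult_right_mono[of \<beta> 2 "1 - w"] by simp_all
    then show "3 / 5 < 1 - \<beta> * (1 - w)" using w by argo
    have "\<beta> * w + \<alpha> = 2 - \<beta> * (1 - w)" using sum by (simp add: algebra_simps)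
    then show "T w = 1 - \<beta> * (1 - w)" using * w
      by (simp add: T_def beta_transformation_def frac_unique_iff)
  qed
  ultimately show False by linarith
qed

theorem theorem2:
  fixes \<beta> \<alpha> :: real
  assumes "\<beta> \<in> {1<..2}" and "\<alpha> \<in> {0..2 - \<beta>}"
  shows "\<not> has_finite_shadowing {0..1} (beta_transformation \<beta> \<alpha>)
       \<and> \<not> has_shadowing {0..1} (beta_transformation \<beta> \<alpha>)"
proof -
  have "\<not> has_finite_shadowing {0..1} (beta_transformation \<beta> \<alpha>)"
  proof (cases "\<beta> + \<alpha> = 2")
    case True
    then show ?thesis using assms(1) by (rule not_has_finite_shadowing_eq2[rotated])
  next
    case False
    then show ?thesis using assms by (intro not_has_finite_shadowing_lt2) auto
  qed
  moreover have "beta_transformation \<beta> \<alpha> ` {0..1} \<subseteq> {0..1}"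
    using beta_transformation_in_unit_interval by blast
  ultimately show ?thesis
    using has_shadowing_imp_has_finite_shadowing by blast
qed

end
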